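(* Let $e\in E$ be a transmission line and $\tilde\tau\in(0,\bar\tau]$ a flow increase. If $S'\in 2^S$ is a set of target substations with $S'\notin\mathcal{S}_\alpha(e,\tilde\tau)$, then $S_\alpha\notin\mathcal{S}_\alpha(e,\tilde\tau)$ for every $S_\alpha\subset S'$.
   Context: Power grid: a finite graph $G=(V,E)$ with $n=|V|$ buses and $m=|E|$ transmission lines, and a finite set of substations $S=\{s_1,\dots,s_{n_s}\}$. Substation $s_k$ has a service area, a subgraph $G_{s_k}=(V_{s_k},E_{s_k})$ of $G$, with $\bigcup_k G_{s_k}=G$; service areas may overlap, but the overlaps contain no buses with generation. Given data: demand $P_d\in\mathbb{R}_{\ge0}^n$, generation limits $\bar P_g\in\mathbb{R}_{\ge0}^n$, line capacities $\bar P_f\in\mathbb{R}_{\ge0}^m$, a generator shift matrix $F\in\mathbb{R}^{m\times n}$ (with row $[F]_e$ for $e\in E$), cost data $c_2,c_1\in\mathbb{R}^n_{\ge0}$, $c_0\in\mathbb{R}$, $C_2=\mathrm{diag}(c_2)$, an attack bound $\bar a>0$, and $\bar\tau>0$. Security Constrained Economic Dispatch (SCED) under an attack signal $a\in\mathbb{R}^n$: minimize $\frac12P_g^\top C_2P_g+c_1^\top P_g+c_0$ over $P_g\in\mathbb{R}^n$ subject to $\mathbf 1^\top P_g=\mathbf 1^\top(P_d+a)$, $\mathbf 0\preceq P_g\preceq\bar P_g$ and $-\bar P_f\preceq F(P_g-P_d-a)\preceq\bar P_f$ (entrywise inequalities). The objective is assumed strictly convex in $P_g$. $P_g^*(a)$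 denotes the optimal solution when the problem is feasible; the problem is assumed feasible for $a=0$. The flow on line $e$ before the attack is $P_{f,e}(0)=[F]_e(P_g^*(0)-P_d)$. A coordinated cyber-attack (CCA) is identified with the set $T\in2^S$ of its target substations. Put $\delta_{s_k}=1$ if $s_k\in T$ and $\delta_{s_k}=0$ otherwise. An attack signal $a\in\mathbb{R}^n$ is admissible for $T$ if $a_i\in\delta_{s_k}[-\bar a,\bar a]$ for all $s_k\in S$ and all $i\in V_{s_k}$. The CCA $T$ is effective for the attack goal $(e,\tilde\tau)$, written $T\to(e,\tilde\tau)$, if there is an admissible $a$ for $T$ such that SCED under $a$ is feasible and $[F]_e(P_g^*(a)-P_d)\ge(1+\tilde\tau)P_{f,e}(0)$ if $P_{f,e}(0)\ge0$, respectively $[F]_e(P_g^*(a)-P_d)\le(1+\tilde\tau)P_{f,e}(0)$ if $P_{f,e}(0)<0$. The set of effective CCAs is $\mathcal{S}_\alpha(e,\tilde\tau)=\{T\in2^S: T\to(e,\tilde\tau)\}$. Convention: $\subset$ denotes proper inclusion, $\subseteq$ inclusion. *)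

theory Defs
  imports "HOL-Analysis.Analysis"
begin

definition strictly_convex_on :: "'a::real_vector set \<Rightarrow> ('a \<Rightarrow> real) \<Rightarrow> bool" where
  "strictly_convex_on A f \<longleftrightarrow> convex A \<and>
    (\<forall>x\<in>A. \<forall>y\<in>A. x \<noteq> y \<longrightarrow>
      (\<forall>u>0. \<forall>v>0. u + v = 1 \<longrightarrow> f (u *\<^sub>R x + v *\<^sub>R y) < u * f x + v * f y))"

(* The graph G = (V, E) has V = (UNIV :: 'v set) and E = (UNIV :: 'l set), so that vectors
   over buses and lines are real^'v and real^'l.  A line l joins the two buses in
   line_ends N l; two lines may have the same ends. *)
record ('v :: finite, 'l :: finite, 's) power_grid =
  line_ends :: "'l \<Rightarrow> 'v set"
  substations :: "'s set"
  area_buses :: "'s \<Rightarrow> 'v set"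
  area_lines :: "'s \<Rightarrow> 'l set"
  demand :: "real ^ 'v"
  gen_limit :: "real ^ 'v"
  line_capacity :: "real ^ 'l"
  shift_matrix :: "real ^ 'v ^ 'l"
  cost2 :: "real ^ 'v"
  cost1 :: "real ^ 'v"
  cost0 :: real
  attack_bound :: real

definition diag :: "real ^ 'v \<Rightarrow> real ^ 'v ^ 'v" where
  "diag d = (\<chi> i j. if i = j then d $ i else 0)"

definition cost :: "('v::finite, 'l::finite, 's) power_grid \<Rightarrow> real ^ 'v \<Rightarrow> real" where
  "cost N Pg = 1/2 * (Pg \<bullet> (diag (cost2 N) *v Pg)) + cost1 N \<bullet> Pg + cost0 N"

(* On real^'n, the library order is entrywise. *)
definition sced_feasible ::
    "('v::finite, 'l::finite, 's) power_grid \<Rightarrow> real ^ 'v \<Rightarrow> real ^ 'v \<Rightarrow> bool" where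
  "sced_feasible N a Pg \<longleftrightarrow>
     vec 1 \<bullet> Pg = vec 1 \<bullet> (demand N + a) \<and>
     0 \<le> Pg \<and> Pg \<le> gen_limit N \<and>
     - line_capacity N \<le> shift_matrix N *v (Pg - demand N - a) \<and>
     shift_matrix N *v (Pg - demand N - a) \<le> line_capacity N"

definition sced_is_feasible ::
    "('v::finite, 'l::finite, 's) power_grid \<Rightarrow> real ^ 'v \<Rightarrow> bool" where
  "sced_is_feasible N a \<longleftrightarrow> (\<exists>Pg. sced_feasible N a Pg)"

(* Meaningful only if SCED under a is feasible: the feasible set is then compact and
   nonempty, and strict convexity of the cost makes the minimizer unique. *)
definition optimal_dispatch ::
    "('v::finite, 'l::finite, 's) power_grid \<Rightarrow> real ^ 'v \<Rightarrow> real ^ 'v" where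
  "optimal_dispatch N a = (THE Pg. is_arg_min (cost N) (sced_feasible N a) Pg)"

(* The bus injections exclude a: this is the physical flow, in contrast to the
   flow F (Pg - Pd - a) seen by the dispatch. *)
definition line_flow ::
    "('v::finite, 'l::finite, 's) power_grid \<Rightarrow> 'l \<Rightarrow> real ^ 'v \<Rightarrow> real" where
  "line_flow N e a = row e (shift_matrix N) \<bullet> (optimal_dispatch N a - demand N)"

(* A bus with generation is a bus with positive generation limit. *)
definition valid_power_grid :: "('v::finite, 'l::finite, 's) power_grid \<Rightarrow> bool" where
  "valid_power_grid N \<longleftrightarrow>
     (\<forall>l. card (line_ends N l) = 2) \<and>
     finite (substations N) \<and>
     (\<forall>s\<in>substations N. \<forall>l\<in>area_lines N s. line_ends N l \<subseteq> area_buses N s) \<and>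
     (\<Union>s\<in>substations N. area_buses N s) = UNIV \<and>
     (\<Union>s\<in>substations N. area_lines N s) = UNIV \<and>
     (\<forall>s\<in>substations N. \<forall>t\<in>substations N. s \<noteq> t \<longrightarrow>
        (\<forall>i\<in>area_buses N s \<inter> area_buses N t. gen_limit N $ i = 0)) \<and>
     0 \<le> demand N \<and> 0 \<le> gen_limit N \<and> 0 \<le> line_capacity N \<and>
     0 \<le> cost2 N \<and> 0 \<le> cost1 N \<and> 0 < attack_bound N \<and>
     strictly_convex_on UNIV (cost N) \<and>
     sced_is_feasible N 0"

definition target_indicator :: "'s set \<Rightarrow> 's \<Rightarrow> real" where
  "target_indicator T s = (if s \<in> T then 1 else 0)"

(* On a bus in several service areas all constraints apply, so a vanishes there unless
   every such area is attacked. *)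
definition admissible_attack ::
    "('v::finite, 'l::finite, 's) power_grid \<Rightarrow> 's set \<Rightarrow> real ^ 'v \<Rightarrow> bool" where
  "admissible_attack N T a \<longleftrightarrow>
     (\<forall>s\<in>substations N. \<forall>i\<in>area_buses N s.
        a $ i \<in> (\<lambda>x. target_indicator T s * x) ` {- attack_bound N .. attack_bound N})"

definition effective_cca ::
    "('v::finite, 'l::finite, 's) power_grid \<Rightarrow> 's set \<Rightarrow> 'l \<Rightarrow> real \<Rightarrow> bool" where
  "effective_cca N T e \<tau> \<longleftrightarrow>
     (\<exists>a. admissible_attack N T a \<and> sced_is_feasible N a \<and>
        (if line_flow N e 0 \<ge> 0
         then line_flow N e a \<ge> (1 + \<tau>) * line_flow N e 0
         else line_flow N e a \<le> (1 + \<tau>) * line_flow N e 0))"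

definition effective_ccas ::
    "('v::finite, 'l::finite, 's) power_grid \<Rightarrow> 'l \<Rightarrow> real \<Rightarrow> 's set set" where
  "effective_ccas N e \<tau> = {T \<in> Pow (substations N). effective_cca N T e \<tau>}"

end

theory Submission
  imports Defs
begin

text \<open>Effectiveness is monotone in the target set, and the claim is the contrapositive. The
  targets restrict only which attack signals are admissible; feasibility of SCED, the optimal
  dispatch and the line flows depend on the signal alone. Enlarging the target set only relaxes the
  bounds on the signal (\<open>admissible_attack_mono\<close>), so a signal that makes
  \<open>S\<alpha>\<close> effective does the same for \<open>S'\<close>
  (\<open>effective_cca_mono\<close>).\<close>

text \<open>For \<open>0 \<le> b\<close> the image is {0} if \<open>s\<close> is not a target and
  [-b, b] if it is, and 0 lies in [-b, b].\<close>

lemma target_interval_mono: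
  assumes "T \<subseteq> T'" "0 \<le> b"
  shows "(\<lambda>x. target_indicator T s * x) ` {-b..b} \<subseteq> (\<lambda>x. target_indicator T' s * x) ` {-b..b}"
  using assms by (auto simp: target_indicator_def image_iff)

lemma admissible_attack_mono:
  assumes "T \<subseteq> T'" "0 \<le> attack_bound N" "admissible_attack N T a"
  shows "admissible_attack N T' a"
  using assms(3) target_interval_mono[OF assms(1,2)]
  unfolding admissible_attack_def by blast

lemma effective_cca_mono:
  assumes "T \<subseteq> T'" "0 \<le> attack_bound N" "effective_cca N T e \<tau>"
  shows "effective_cca N T' e \<tau>"
  using assms(3) admissible_attack_mono[OF assms(1,2)]
  unfolding effective_cca_def by blast

theorem proposition1:
  fixes N :: "('v::finite, 'l::finite, 's) power_grid"
    and e :: 'l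
    and \<tau> \<tau>max :: real
    and S' :: "'s set"
  assumes "valid_power_grid N"
    and "0 < \<tau>max"
    and "\<tau> \<in> {0<..\<tau>max}"
    and "S' \<in> Pow (substations N)"
    and "S' \<notin> effective_ccas N e \<tau>"
  shows "\<forall>S\<alpha>. S\<alpha> \<subset> S' \<longrightarrow> S\<alpha> \<notin> effective_ccas N e \<tau>"
proof (intro allI impI notI)
  fix S\<alpha>
  assume "S\<alpha> \<subset> S'" and "S\<alpha> \<in> effective_ccas N e \<tau>"
  moreover have "0 \<le> attack_bound N"
    using assms(1) by (simp add: valid_power_grid_def)
  ultimately have "effective_cca N S' e \<tau>"
    using effective_cca_mono[of S\<alpha> S' N e \<tau>] by (auto simp: effective_ccas_def)
  \<comment> \<open>As \<open>S'\<close> consists of substations, it can be missing from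
    \<open>effective_ccas N e \<tau>\<close> only by not being effective.\<close>
  then show False
    using assms(4,5) by (simp add: effective_ccas_def)
qed

end
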